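(* Assume that $r_{12}=r_{32}=0$ and $c_2<r_{21}+r_{23}$. Then $I^*=(y^{c_2},z^{c_3})$.
   Context: Let $K$ be a field and let $n_1<n_2<n_3$ be positive integers with $\gcd(n_1,n_2,n_3)=1$ that minimally generate the numerical semigroup $H=\langle n_1,n_2,n_3\rangle$. Let $S=K[x,y,z]$ with the standard grading, and let $I=I_H$ be the kernel of $S\to K[t]$, $x\mapsto t^{n_1}$, $y\mapsto t^{n_2}$, $z\mapsto t^{n_3}$. For nonzero $f\in S$, $f^*$ is its homogeneous component of smallest degree, and $I^*=(f^*\mid 0\neq f\in I)$. Let $c_1,c_2,c_3$ be the smallest positive integers such that $c_1n_1\in\langle n_2,n_3\rangle$, $c_2n_2\in\langle n_1,n_3\rangle$, $c_3n_3\in\langle n_1,n_2\rangle$, and let $r_{ij}$ be non-negative integers with $c_1n_1=r_{12}n_2+r_{13}n_3$, $c_2n_2=r_{21}n_1+r_{23}n_3$, $c_3n_3=r_{31}n_1+r_{32}n_2$. *)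

theory Defs
  imports
    "HOL-Library.Poly_Mapping"
    "HOL-Library.Product_Plus"
    "HOL-Computational_Algebra.Polynomial"
begin

inductive_set semigroup_gen :: "nat set \<Rightarrow> nat set" for A :: "nat set" where
  zero: "0 \<in> semigroup_gen A"
| add: "a \<in> A \<Longrightarrow> h \<in> semigroup_gen A \<Longrightarrow> a + h \<in> semigroup_gen A"

definition minimally_generates :: "nat set \<Rightarrow> nat set \<Rightarrow> bool" where
  "minimally_generates A H \<longleftrightarrow>
     semigroup_gen A = H \<and> (\<forall>B. B \<subset> A \<longrightarrow> semigroup_gen B \<noteq> H)"

text \<open>
  \<open>K[x,y,z]\<close> is the monoid algebra over \<open>K\<close> of the additive monoid of exponent triples;
  \<open>(a, b, c)\<close> stands for the monomial \<open>x^a y^b z^c\<close>.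
\<close>

type_synonym 'k poly3 = "(nat \<times> nat \<times> nat) \<Rightarrow>\<^sub>0 'k"

abbreviation varX :: "'k::field poly3" where "varX \<equiv> Poly_Mapping.single (1, 0, 0) 1"
abbreviation varY :: "'k::field poly3" where "varY \<equiv> Poly_Mapping.single (0, 1, 0) 1"
abbreviation varZ :: "'k::field poly3" where "varZ \<equiv> Poly_Mapping.single (0, 0, 1) 1"

text \<open>The ideal generated by a set: its span in the ring regarded as a module over itself.\<close>

definition ideal_gen :: "'a::comm_ring_1 set \<Rightarrow> 'a set" where
  "ideal_gen B = module.span (*) B"

definition eval3 :: "'k::field poly \<Rightarrow> 'k poly \<Rightarrow> 'k poly \<Rightarrow> 'k poly3 \<Rightarrow> 'k poly" where
  "eval3 p q r f =
     (\<Sum>(a, b, c)\<in>Poly_Mapping.keys f.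
        smult (Poly_Mapping.lookup f (a, b, c)) (p ^ a * q ^ b * r ^ c))"

definition semigroup_ideal :: "nat \<Rightarrow> nat \<Rightarrow> nat \<Rightarrow> 'k::field poly3 set" where
  "semigroup_ideal n1 n2 n3 = {f. eval3 (monom 1 n1) (monom 1 n2) (monom 1 n3) f = 0}"

fun mdeg :: "nat \<times> nat \<times> nat \<Rightarrow> nat" where
  "mdeg (a, b, c) = a + b + c"

definition hom_component :: "nat \<Rightarrow> 'k::field poly3 \<Rightarrow> 'k poly3" where
  "hom_component d f =
     (\<Sum>m\<in>{m \<in> Poly_Mapping.keys f. mdeg m = d}.
        Poly_Mapping.single m (Poly_Mapping.lookup f m))"

text \<open>Meaningful for \<open>f \<noteq> 0\<close> only, as \<open>Min {}\<close> is unspecified.\<close>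

definition initial_form :: "'k::field poly3 \<Rightarrow> 'k poly3" where
  "initial_form f = hom_component (Min (mdeg ` Poly_Mapping.keys f)) f"

definition initial_ideal :: "'k::field poly3 set \<Rightarrow> 'k poly3 set" where
  "initial_ideal J = ideal_gen {initial_form f | f. f \<in> J \<and> f \<noteq> 0}"

lemma lookup_hom_component:
  "Poly_Mapping.lookup (hom_component d f) m =
     (if mdeg m = d then Poly_Mapping.lookup f m else 0)"
proof -
  have "Poly_Mapping.lookup (hom_component d f) m =
      (\<Sum>k\<in>{k \<in> Poly_Mapping.keys f. mdeg k = d}. if k = m then Poly_Mapping.lookup f k else 0)"
    unfolding hom_component_def lookup_sum by (simp add: lookup_single when_def)
  then show ?thesis by (auto simp: in_keys_iff sum.delta)
qed

text \<open>\<open>eval3 p q r\<close> is the \<open>K\<close>-algebra homomorphism with \<open>x \<mapsto> p\<close>, \<open>y \<mapsto> q\<close>, \<open>z \<mapsto> r\<close>.\<close>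

lemma eval3_superset:
  assumes "finite A" "Poly_Mapping.keys f \<subseteq> A"
  shows "eval3 p q r f = (\<Sum>(a, b, c)\<in>A.
           smult (Poly_Mapping.lookup f (a, b, c)) (p ^ a * q ^ b * r ^ c))"
  unfolding eval3_def using assms
  by (intro sum.mono_neutral_left) (auto simp: in_keys_iff)

lemma eval3_add: "eval3 p q r (f + g) = eval3 p q r f + eval3 p q r g"
proof -
  let ?A = "Poly_Mapping.keys f \<union> Poly_Mapping.keys g"
  have A: "finite ?A" "Poly_Mapping.keys (f + g) \<subseteq> ?A"
    using keys_add[of f g] by auto
  show ?thesis
    using A by (simp add: eval3_superset[of ?A] lookup_add smult_add_left sum.distrib
      case_prod_unfold)
qed

lemma eval3_single:
  "eval3 p q r (Poly_Mapping.single (a, b, c) k) = smult k (p ^ a * q ^ b * r ^ c)"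
  by (simp add: eval3_superset[of "{(a, b, c)}"])

lemma eval3_sum: "eval3 p q r (sum F A) = (\<Sum>i\<in>A. eval3 p q r (F i))"
  by (induction A rule: infinite_finite_induct) (auto simp: eval3_add, simp_all add: eval3_def)

lemma poly3_expand:
  "(f :: 'k::field poly3) =
     (\<Sum>m\<in>Poly_Mapping.keys f. Poly_Mapping.single m (Poly_Mapping.lookup f m))"
  by (rule poly_mapping_eqI) (auto simp: lookup_sum lookup_single when_def in_keys_iff sum.delta)

lemma eval3_mult: "eval3 p q r (f * g) = eval3 p q r f * eval3 p q r g"
proof -
  have single: "eval3 p q r (Poly_Mapping.single m k * Poly_Mapping.single m' k') =
      eval3 p q r (Poly_Mapping.single m k) * eval3 p q r (Poly_Mapping.single m' k')"
    for m m' k k'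
    by (cases m; cases m')
      (simp add: mult_single eval3_single power_add algebra_simps)
  define F where "F m = Poly_Mapping.single m (Poly_Mapping.lookup f m)" for m
  define G where "G m = Poly_Mapping.single m (Poly_Mapping.lookup g m)" for m
  have f: "f = sum F (Poly_Mapping.keys f)" and g: "g = sum G (Poly_Mapping.keys g)"
    unfolding F_def G_def by (rule poly3_expand)+
  have "eval3 p q r (sum F A * sum G B) = eval3 p q r (sum F A) * eval3 p q r (sum G B)" for A B
    by (simp only: sum_product eval3_sum F_def G_def single)
  with f g show ?thesis by metis
qed

lemma eval3_1: "eval3 p q r 1 = 1"
  using eval3_single[of p q r 0 0 0 1] by (simp add: single_one zero_prod_def[symmetric])

lemma eval3_vars: "eval3 p q r varX = p" "eval3 p q r varY = q" "eval3 p q r varZ = r"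
  by (simp_all add: eval3_single)

end

theory Submission
  imports Defs
begin

text \<open>
  Minimality of \<open>c1\<close> and \<open>c3\<close> forces \<open>r13 = c3\<close> and \<open>r31 = c1\<close>, so \<open>I\<close> contains the two
  binomials \<open>z^c3 - x^c1\<close> and \<open>y^c2 - x^r21 z^r23\<close>.  In both of them the first monomial has the
  strictly smaller degree (\<open>c3 < c1\<close> because \<open>n1 < n3\<close>), so \<open>z^c3\<close> and \<open>y^c2\<close> are
  initial forms.

  For the other inclusion give \<open>x^a y^b z^c\<close> the weight \<open>a n1 + b n2 + c n3\<close>, and call it standard
  if it lies outside \<open>(y^c2, z^c3)\<close>.  Replacing \<open>y^c2\<close> by \<open>x^r21 z^r23\<close>
  and \<open>z^c3\<close> by \<open>x^c1\<close> keeps the weight and strictly raises the degree, which the weight bounds;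
  hence every non-standard monomial has the weight of a standard one of strictly larger degree
  (\<open>exists_standard\<close>).  Minimality of the \<open>c\<close>s makes the standard monomial of a given weight unique
  (\<open>standard_unique\<close>).  So a standard monomial has the largest degree in its weight, strictly
  (\<open>standard_degree_max\<close>).  But a monomial of an element of \<open>I\<close> never stands alone in its weight,
  since the coefficients of each weight add up to \<open>0\<close> (\<open>same_weight_partner\<close>).  A standard
  monomial of \<open>f \<in> I\<close> therefore comes with a monomial of smaller degree and is not in \<open>f\<^sup>*\<close>.
\<close>

section \<open>Ideals generated by monomials\<close>

lemma module_self: "module ((*) :: 'a::comm_ring_1 \<Rightarrow> 'a \<Rightarrow> 'a)"
  by unfold_locales (simp_all add: algebra_simps)

lemma ideal_gen_base: "b \<in> B \<Longrightarrow> b \<in> ideal_gen B"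
  unfolding ideal_gen_def by (rule module.span_base[OF module_self])

lemma ideal_gen_sum: "(\<And>i. i \<in> A \<Longrightarrow> F i \<in> ideal_gen B) \<Longrightarrow> sum F A \<in> ideal_gen B"
  unfolding ideal_gen_def by (rule module.span_sum[OF module_self])

lemma ideal_gen_mult: "x \<in> ideal_gen B \<Longrightarrow> y * x \<in> ideal_gen B"
  unfolding ideal_gen_def by (rule module.span_scale[OF module_self])

lemma ideal_gen_minimal:
  assumes "A \<subseteq> ideal_gen B"
  shows "ideal_gen A \<subseteq> ideal_gen B"
  using assms unfolding ideal_gen_def
  by (intro module.span_minimal[OF module_self] module.subspace_span[OF module_self])

lemma ideal_gen_monomialsI:
  fixes f :: "'k::field poly3"
  assumes "\<And>m. m \<in> Poly_Mapping.keys f \<Longrightarrow> \<exists>u v. m = u + v \<and> Poly_Mapping.single v 1 \<in> B"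
  shows "f \<in> ideal_gen B"
proof -
  have "Poly_Mapping.single m (Poly_Mapping.lookup f m) \<in> ideal_gen B"
    if "m \<in> Poly_Mapping.keys f" for m
  proof -
    obtain u v where m: "m = u + v" and v: "Poly_Mapping.single v 1 \<in> B"
      using assms \<open>m \<in> Poly_Mapping.keys f\<close> by blast
    have "Poly_Mapping.single m (Poly_Mapping.lookup f m) =
        Poly_Mapping.single u (Poly_Mapping.lookup f m) * Poly_Mapping.single v 1"
      by (simp add: m mult_single)
    then show ?thesis
      using v by (simp add: ideal_gen_base ideal_gen_mult)
  qed
  then have "(\<Sum>m\<in>Poly_Mapping.keys f. Poly_Mapping.single m (Poly_Mapping.lookup f m))
      \<in> ideal_gen B"
    by (rule ideal_gen_sum)
  then show ?thesis
    by (simp flip: poly3_expand)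
qed

lemma varY_power: "(varY :: 'k::field poly3) ^ k = Poly_Mapping.single (0, k, 0) 1"
  by (induction k) (simp_all add: mult_single flip: single_one zero_prod_def)

lemma varZ_power: "(varZ :: 'k::field poly3) ^ k = Poly_Mapping.single (0, 0, k) 1"
  by (induction k) (simp_all add: mult_single flip: single_one zero_prod_def)

section \<open>Initial forms\<close>

lemma keys_initial_formD:
  assumes "m \<in> Poly_Mapping.keys (initial_form f)"
  shows "m \<in> Poly_Mapping.keys f"
    and "m' \<in> Poly_Mapping.keys f \<Longrightarrow> mdeg m \<le> mdeg m'"
proof -
  have m: "mdeg m = Min (mdeg ` Poly_Mapping.keys f)" "m \<in> Poly_Mapping.keys f"
    using assms unfolding initial_form_def
    by (auto simp: in_keys_iff lookup_hom_component split: if_splits)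
  then show "m \<in> Poly_Mapping.keys f" by simp
  show "mdeg m \<le> mdeg m'" if "m' \<in> Poly_Mapping.keys f"
    using that m(1) by simp
qed

lemma initial_form_binomial:
  assumes "mdeg m < mdeg m'"
  shows "initial_form (Poly_Mapping.single m 1 - Poly_Mapping.single m' 1 :: 'k::field poly3) =
    Poly_Mapping.single m 1"
proof -
  let ?f = "Poly_Mapping.single m 1 - Poly_Mapping.single m' 1 :: 'k poly3"
  have "m \<noteq> m'" using assms by auto
  then have "Poly_Mapping.keys ?f = {m, m'}"
    by (auto simp: in_keys_iff lookup_minus lookup_single when_def split: if_splits)
  then have "Min (mdeg ` Poly_Mapping.keys ?f) = mdeg m"
    using assms by simp
  then show ?thesis
    unfolding initial_form_def using assms
    by (intro poly_mapping_eqI)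
      (auto simp: lookup_hom_component lookup_minus lookup_single when_def)
qed

section \<open>The weight grading\<close>

fun weight :: "nat \<Rightarrow> nat \<Rightarrow> nat \<Rightarrow> nat \<times> nat \<times> nat \<Rightarrow> nat" where
  "weight n1 n2 n3 (a, b, c) = a * n1 + b * n2 + c * n3"

lemma coeff_eval3_monom:
  "coeff (eval3 (monom 1 n1) (monom 1 n2) (monom 1 n3) f) w =
     (\<Sum>m\<in>Poly_Mapping.keys f. if weight n1 n2 n3 m = w then Poly_Mapping.lookup f m else 0)"
  unfolding eval3_def
  by (auto simp: coeff_sum monom_power mult_monom smult_monom mult.commute intro!: sum.cong)

text \<open>The coefficients of each weight in an element of the ideal cancel.\<close>

lemma same_weight_partner:
  assumes "f \<in> semigroup_ideal n1 n2 n3" "m \<in> Poly_Mapping.keys f"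
  shows "\<exists>m'\<in>Poly_Mapping.keys f. m' \<noteq> m \<and> weight n1 n2 n3 m' = weight n1 n2 n3 m"
proof (rule ccontr)
  assume "\<not> ?thesis"
  then have alone: "m' = m" if "m' \<in> Poly_Mapping.keys f" "weight n1 n2 n3 m' = weight n1 n2 n3 m"
    for m'
    using that by blast
  have "0 = coeff (eval3 (monom 1 n1) (monom 1 n2) (monom 1 n3) f) (weight n1 n2 n3 m)"
    using assms(1) by (simp add: semigroup_ideal_def)
  also have "\<dots> = (\<Sum>m'\<in>Poly_Mapping.keys f. if m' = m then Poly_Mapping.lookup f m' else 0)"
    unfolding coeff_eval3_monom by (intro sum.cong) (auto dest: alone)
  also have "\<dots> = Poly_Mapping.lookup f m"
    using assms(2) by simp
  finally show False
    using assms(2) by (simp add: in_keys_iff)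
qed

lemma binomial_in_semigroup_ideal:
  assumes "weight n1 n2 n3 m = weight n1 n2 n3 m'"
  shows "Poly_Mapping.single m 1 - Poly_Mapping.single m' 1
    \<in> (semigroup_ideal n1 n2 n3 :: 'k::field poly3 set)"
proof -
  have eval: "eval3 (monom 1 n1) (monom 1 n2) (monom 1 n3) (Poly_Mapping.single v k) =
      monom (k :: 'k) (weight n1 n2 n3 v)" for v k
    by (cases v) (simp add: eval3_single monom_power mult_monom smult_monom algebra_simps)
  have "Poly_Mapping.single m (1::'k) - Poly_Mapping.single m' 1 =
      Poly_Mapping.single m 1 + Poly_Mapping.single m' (- 1)"
    by (simp add: single_uminus)
  also have "eval3 (monom 1 n1) (monom 1 n2) (monom 1 n3) \<dots> = 0"
    unfolding eval3_add eval by (simp add: assms add_monom)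
  finally show ?thesis
    by (simp add: semigroup_ideal_def)
qed

section \<open>Standard monomials\<close>

text \<open>
  The numerical data behind the two binomials \<open>y^c2 - x^r z^s\<close> and \<open>z^c3 - x^c1\<close>: both are
  homogeneous for the weight, and in both the monomial to be rewritten has the smaller degree.
\<close>

locale two_relations =
  fixes n1 n2 n3 c1 c2 c3 r s :: nat
  assumes pos: "0 < n1" "0 < n2" "0 < n3"
    and least1: "\<And>k a b. 0 < k \<Longrightarrow> k * n1 = a * n2 + b * n3 \<Longrightarrow> c1 \<le> k"
    and least2: "\<And>k a b. 0 < k \<Longrightarrow> k * n2 = a * n1 + b * n3 \<Longrightarrow> c2 \<le> k"
    and least3: "\<And>k a b. 0 < k \<Longrightarrow> k * n3 = a * n1 + b * n2 \<Longrightarrow> c3 \<le> k"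
    and rel_z: "c3 * n3 = c1 * n1" and degree_z: "c3 < c1"
    and rel_y: "c2 * n2 = r * n1 + s * n3" and degree_y: "c2 < r + s"
begin

fun standard :: "nat \<times> nat \<times> nat \<Rightarrow> bool" where
  "standard (a, b, c) \<longleftrightarrow> b < c2 \<and> c < c3"

text \<open>
  If the monomials differ, cancelling common factors leaves two coprime monomials of equal weight.
  One of them is a pure power, and its exponent is at least the corresponding \<open>c\<close>.  For \<open>y\<close> and \<open>z\<close> this is excluded at once;
  for \<open>x\<close> the relation \<open>c1 n1 = c3 n3\<close> trades \<open>x^c1\<close> for \<open>z^c3\<close>, which leads
  back to a pure power of \<open>y\<close>.
\<close>

lemma standard_unique_aux:
  assumes "b' \<le> b" "b < c2" "c < c3" "c' < c3"
    and eq: "a * n1 + b * n2 + c * n3 = a' * n1 + b' * n2 + c' * n3"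
  shows "(a, b, c) = (a', b', c')"
proof -
  obtain d where b: "b = b' + d" using assms(1) le_Suc_ex by blast
  have E: "a * n1 + d * n2 + c * n3 = a' * n1 + c' * n3"
    using eq by (simp add: b algebra_simps)
  consider (up) i j where "a' = a + i" "c' = c + j" | (right) i j where "a' = a + i" "c = c' + j" "0 < j"
    | (left) i j where "a = a' + i" "c' = c + j" "0 < i" | (down) i j where "a = a' + i" "c = c' + j"
    using le_Suc_ex[of a a'] le_Suc_ex[of a' a] le_Suc_ex[of c c'] le_Suc_ex[of c' c]
    by (metis nat_le_linear less_add_same_cancel1 linorder_not_le order_le_imp_less_or_eq)
  then show ?thesis
  proof cases
    case (up i j)
    then have d: "d * n2 = i * n1 + j * n3" using E by (simp add: algebra_simps)
    have "d = 0" using least2[OF _ d] assms(2) b by linarith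
    then show ?thesis using d up b pos by simp
  next
    case (right i j)
    then have i: "i * n1 = d * n2 + j * n3" using E by (simp add: algebra_simps)
    have "0 < i" using i right pos by (cases i) auto
    then have "c1 \<le> i" using least1 i by blast
    then obtain k where k: "i = c1 + k" using le_Suc_ex by blast
    have "j < c3" using right assms(3) by simp
    then obtain l where l: "c3 = j + l" using less_imp_add_positive by blast
    have d: "d * n2 = k * n1 + l * n3" using i rel_z by (simp add: k l algebra_simps)
    have "0 < d" using d \<open>j < c3\<close> l pos by (cases d) auto
    then show ?thesis using least2[OF _ d] assms(2) b by linarith
  next
    case (left i j)
    then have j: "j * n3 = i * n1 + d * n2" using E by (simp add: algebra_simps)
    have "0 < j" using j left pos by (cases j) auto
    then show ?thesis using least3[OF _ j] assms(4) left by linarith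
  next
    case (down i j)
    then have "i * n1 + d * n2 + j * n3 = 0" using E by (simp add: algebra_simps)
    then show ?thesis using pos down b by simp
  qed
qed

lemma standard_unique:
  assumes "standard m" "standard m'" "weight n1 n2 n3 m = weight n1 n2 n3 m'"
  shows "m = m'"
proof -
  obtain a b c a' b' c' where m: "m = (a, b, c)" "m' = (a', b', c')"
    by (metis prod_cases3)
  show ?thesis
  proof (cases "b' \<le> b")
    case True
    then show ?thesis using standard_unique_aux[of b' b c c' a a'] assms by (simp add: m)
  next
    case False
    then show ?thesis using standard_unique_aux[of b b' c' c a' a] assms by (simp add: m)
  qed
qed

lemma mdeg_le_weight: "mdeg m \<le> weight n1 n2 n3 m"
proof (cases m)
  case (fields a b c)
  then show ?thesis
    using pos by (simp add: add_mono)
qed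

lemma rewrite_step:
  assumes "\<not> standard m"
  obtains m' where "weight n1 n2 n3 m' = weight n1 n2 n3 m" "mdeg m < mdeg m'"
proof -
  obtain a b c where m: "m = (a, b, c)" by (rule prod_cases3)
  consider (y) k where "b = c2 + k" | (z) k where "c = c3 + k"
    using assms le_Suc_ex[of c2 b] le_Suc_ex[of c3 c] by (fastforce simp: m not_less)
  then show thesis
  proof cases
    case (y k)
    then show thesis
      using that[of "(a + r, k, c + s)"] rel_y degree_y by (simp add: m algebra_simps)
  next
    case (z k)
    then show thesis
      using that[of "(a + c1, b, k)"] rel_z degree_z by (simp add: m algebra_simps)
  qed
qed

lemma exists_standard:
  assumes "\<not> standard m"
  shows "\<exists>m'. standard m' \<and> weight n1 n2 n3 m' = weight n1 n2 n3 m \<and> mdeg m < mdeg m'"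
  using assms
proof (induction "weight n1 n2 n3 m - mdeg m" arbitrary: m rule: less_induct)
  case less
  obtain m1 where m1: "weight n1 n2 n3 m1 = weight n1 n2 n3 m" "mdeg m < mdeg m1"
    using rewrite_step less.prems by blast
  show ?case
  proof (cases "standard m1")
    case True
    then show ?thesis using m1 by blast
  next
    case False
    have "weight n1 n2 n3 m1 - mdeg m1 < weight n1 n2 n3 m - mdeg m"
      using m1 mdeg_le_weight[of m1] by simp
    then show ?thesis using less.hyps[OF _ False] m1 by (metis order.strict_trans)
  qed
qed

lemma standard_degree_max:
  assumes "standard m" "m' \<noteq> m" "weight n1 n2 n3 m' = weight n1 n2 n3 m"
  shows "mdeg m' < mdeg m"
proof -
  have "\<not> standard m'" using standard_unique assms by blast
  then obtain m'' where "standard m''" "weight n1 n2 n3 m'' = weight n1 n2 n3 m'" "mdeg m' < mdeg m''"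
    using exists_standard by blast
  moreover from this have "m'' = m" using standard_unique assms by metis
  ultimately show ?thesis by simp
qed

lemma initial_ideal_eq:
  "initial_ideal (semigroup_ideal n1 n2 n3 :: 'k::field poly3 set) =
     ideal_gen {varY ^ c2, varZ ^ c3}"
proof
  let ?I = "semigroup_ideal n1 n2 n3 :: 'k poly3 set"
  show "initial_ideal ?I \<subseteq> ideal_gen {varY ^ c2, varZ ^ c3}"
    unfolding initial_ideal_def
  proof (intro ideal_gen_minimal subsetI)
    fix g assume "g \<in> {initial_form f |f. f \<in> ?I \<and> f \<noteq> 0}"
    then obtain f where f: "f \<in> ?I" and g: "g = initial_form f" by blast
    show "g \<in> ideal_gen {varY ^ c2, varZ ^ c3}"
    proof (rule ideal_gen_monomialsI)
      fix m assume m: "m \<in> Poly_Mapping.keys g"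
      then obtain m' where "m' \<in> Poly_Mapping.keys f" "m' \<noteq> m"
        "weight n1 n2 n3 m' = weight n1 n2 n3 m"
        using f unfolding g by (metis keys_initial_formD(1) same_weight_partner)
      moreover from this have "mdeg m \<le> mdeg m'"
        using m keys_initial_formD(2) g by blast
      ultimately have "\<not> standard m" using standard_degree_max by (meson not_less)
      moreover obtain a b c where abc: "m = (a, b, c)" by (rule prod_cases3)
      ultimately consider "c2 \<le> b" | "c3 \<le> c" by (auto simp: not_less)
      then show "\<exists>u v. m = u + v \<and> Poly_Mapping.single v 1 \<in> {varY ^ c2, varZ ^ c3 :: 'k poly3}"
      proof cases
        case 1
        then have "m = (a, b - c2, c) + (0, c2, 0)" by (simp add: abc)
        then show ?thesis by (metis varY_power insertI1)
      next
        case 2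
        then have "m = (a, b, c - c3) + (0, 0, c3)" by (simp add: abc)
        then show ?thesis by (metis varZ_power insertI1 insertI2)
      qed
    qed
  qed
  have initial: "Poly_Mapping.single m 1 \<in> initial_ideal ?I"
    if "weight n1 n2 n3 m = weight n1 n2 n3 m'" "mdeg m < mdeg m'" for m m'
  proof -
    let ?f = "Poly_Mapping.single m 1 - Poly_Mapping.single m' 1 :: 'k poly3"
    have "?f \<noteq> 0"
    proof
      assume "?f = 0"
      then have "Poly_Mapping.keys (Poly_Mapping.single m (1::'k)) =
          Poly_Mapping.keys (Poly_Mapping.single m' (1::'k))" by simp
      then show False using that(2) by simp
    qed
    then have "initial_form ?f \<in> initial_ideal ?I"
      unfolding initial_ideal_def
      by (intro ideal_gen_base) (use that(1) binomial_in_semigroup_ideal in blast)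
    then show ?thesis by (simp only: initial_form_binomial[OF that(2)])
  qed
  have "varY ^ c2 \<in> initial_ideal ?I"
    unfolding varY_power using rel_y degree_y by (intro initial[of _ "(r, 0, s)"]) simp_all
  moreover have "varZ ^ c3 \<in> initial_ideal ?I"
    unfolding varZ_power using rel_z degree_z by (intro initial[of _ "(c1, 0, 0)"]) simp_all
  ultimately show "ideal_gen {varY ^ c2, varZ ^ c3} \<subseteq> initial_ideal ?I"
    unfolding initial_ideal_def by (intro ideal_gen_minimal) simp
qed

end

section \<open>The relations of the semigroup\<close>

lemma combination_in_semigroup_gen: "a * p + b * q \<in> semigroup_gen {p, q}"
proof (induction a)
  case 0
  show ?case
    by (induction b) (auto intro: semigroup_gen.intros)
next
  case (Suc a)
  then show ?case
    using semigroup_gen.add[of p "{p, q}" "a * p + b * q"] by (simp add: add.assoc)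
qed

lemma least_multiple_le:
  assumes "c = (LEAST c. 0 < c \<and> c * n \<in> semigroup_gen {p, q})"
    and "0 < k" "k * n = a * p + b * q"
  shows "c \<le> k"
  unfolding assms(1) by (rule Least_le) (simp add: assms combination_in_semigroup_gen)

lemma least_multiple_pos:
  assumes "c = (LEAST c. 0 < c \<and> c * n \<in> semigroup_gen {p, q})" "0 < p"
  shows "0 < c"
proof -
  have "0 < p \<and> p * n \<in> semigroup_gen {p, q}"
    using combination_in_semigroup_gen[of n p 0 q] assms(2) by (simp add: mult.commute)
  then show ?thesis
    unfolding assms(1) by (rule LeastI2) simp
qed

theorem lemma3p9:
  fixes n1 n2 n3 c1 c2 c3 r12 r13 r21 r23 r31 r32 :: nat
  assumes "0 < n1" and "n1 < n2" and "n2 < n3"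
    and "gcd n1 (gcd n2 n3) = 1"
    and "minimally_generates {n1, n2, n3} (semigroup_gen {n1, n2, n3})"
    and "c1 = (LEAST c. 0 < c \<and> c * n1 \<in> semigroup_gen {n2, n3})"
    and "c2 = (LEAST c. 0 < c \<and> c * n2 \<in> semigroup_gen {n1, n3})"
    and "c3 = (LEAST c. 0 < c \<and> c * n3 \<in> semigroup_gen {n1, n2})"
    and "c1 * n1 = r12 * n2 + r13 * n3"
    and "c2 * n2 = r21 * n1 + r23 * n3"
    and "c3 * n3 = r31 * n1 + r32 * n2"
    and "r12 = 0" and "r32 = 0"
    and "c2 < r21 + r23"
  shows "initial_ideal (semigroup_ideal n1 n2 n3 :: 'k::field poly3 set) =
           ideal_gen {varY ^ c2, varZ ^ c3}"
proof -
  note least1 = least_multiple_le[OF assms(6)] and least3 = least_multiple_le[OF assms(8)]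
  have n: "0 < n2" "0 < n3" using assms(1-3) by auto
  have c: "0 < c1" "0 < c3"
    using least_multiple_pos[OF assms(6)] least_multiple_pos[OF assms(8)] n assms(1) by auto
  have x: "c1 * n1 = r13 * n3" and z: "c3 * n3 = r31 * n1"
    using assms(9,11-13) by simp_all
  \<comment> \<open>\<open>c1 n1 = r13 n3 \<ge> c3 n3 = r31 n1 \<ge> c1 n1\<close>, so equality holds throughout.\<close>
  have "0 < r13" using x c(1) assms(1) by (cases r13) auto
  then have "c3 \<le> r13" using least3[of r13 c1 0] x by simp
  then have "c3 * n3 \<le> c1 * n1" using x by simp
  have "0 < r31" using z c(2) n(2) by (cases r31) auto
  then have "c1 \<le> r31" using least1[of r31 0 c3] z by simp
  then have "c1 * n1 \<le> c3 * n3" using z by simp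
  with \<open>c3 * n3 \<le> c1 * n1\<close> have rel: "c3 * n3 = c1 * n1" by simp
  have "c3 < c1"
  proof (rule ccontr)
    assume "\<not> c3 < c1"
    then have "c1 * n1 \<le> c3 * n1" by simp
    also have "c3 * n1 < c3 * n3" using c(2) assms(2,3) by simp
    finally show False using rel by simp
  qed
  interpret two_relations n1 n2 n3 c1 c2 c3 r21 r23
    using assms(1,10,14) n rel \<open>c3 < c1\<close> least1 least3 least_multiple_le[OF assms(7)]
    by unfold_locales
  show ?thesis by (rule initial_ideal_eq)
qed

end
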